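(* Let $n\geq 4$ and $0\le p\le 1$. In the $n$-dimensional bubble-sort network $B_n$ under the random node fault model in which each node is fault-free independently with probability $p$, $$P(1,0,3)=\tfrac{4}{3}(8n^5-50n^4+115n^3-115n^2+42n)p^{4(n-2)!}+(8n^6-74n^5+265n^4-460n^3+387n^2-126n)p^{4(n-2)!-(n-4)!}+(2n^7-25n^6+125n^5-320n^4+443n^3-315n^2+90n)p^{4(n-2)!-2(n-4)!}+\tfrac{1}{6}(n^8-16n^7+105n^6-365n^5+724n^4-819n^3+490n^2-120n)p^{4(n-2)!-3(n-4)!}.$$
   Context: Let $N_n=\{1,\dots,n\}$. The bubble-sort network $B_n$ has as vertices the permutations of $N_n$, written as strings $u_1u_2\cdots u_n$, two permutations being adjacent iff they differ by swapping two adjacent positions $u_i,u_{i+1}$. For distinct $a_1,a_2\in N_n$, a $B_{n-2}$-subnetwork of $B_n$ is one of the following vertex sets (each inducing a copy of $B_{n-2}$ and having $(n-2)!$ vertices): $a_1a_2X^{n-2}$, the set of permutations with $u_1=a_1,u_2=a_2$ ("prefix form"); $a_1X^{n-2}a_2$, the set with $u_1=a_1,u_n=a_2$ ("middle form"); $X^{n-2}a_1a_2$, the set with $u_{n-1}=a_1,u_n=a_2$ ("suffix form"). Each form gives $n(n-1)$ subnetworks. In the random node fault model each vertex is fault-free independently with probability $p$ (faulty with probability $1-p$); a subnetwork is fault-free if all its vertices are. For nonnegative integers $i,j,k$ with $i+j+k=4$, $P(i,j,k)$ denotes the sum, over all sets $S$ of four distinct $B_{n-2}$-subnetworks consisting of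 $i$ of prefix form, $j$ of middle form and $k$ of suffix form, of the probability that all four members of $S$ are fault-free, i.e. of $p^{|\bigcup_{H\in S}H|}$. (The paper calls $P(i,j,k)$ "the probability that there are four fault-free $B_{n-2}$'s, $i$ of which are of prefix form, $j$ of middle form and $k$ of suffix form".) *)

theory Defs
  imports
    "HOL-Combinatorics.Multiset_Permutations"
    "HOL-Probability.Product_PMF"
    "Graph_Theory.Pair_Digraph"
begin

text \<open>
  Vertices are lists \<open>u\<close> with \<open>u ! 0\<close> playing the role of $u_1$ and \<open>u ! (n - 1)\<close> that of $u_n$.
  The undirected graph is represented by its symmetric arc relation.
\<close>

definition bubble_sort_network :: "nat \<Rightarrow> nat list pair_pre_digraph" where
  "bubble_sort_network n =
     \<lparr> pverts = permutations_of_set {1..n},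
       parcs = {(u, v). u \<in> permutations_of_set {1..n} \<and>
                 (\<exists>i. Suc i < n \<and> v = u[i := u ! Suc i, Suc i := u ! i])} \<rparr>"

definition prefix_subnetwork :: "nat \<Rightarrow> nat \<Rightarrow> nat \<Rightarrow> nat list set" where
  "prefix_subnetwork n a1 a2 =
     {u \<in> pverts (bubble_sort_network n). u ! 0 = a1 \<and> u ! 1 = a2}"

definition middle_subnetwork :: "nat \<Rightarrow> nat \<Rightarrow> nat \<Rightarrow> nat list set" where
  "middle_subnetwork n a1 a2 =
     {u \<in> pverts (bubble_sort_network n). u ! 0 = a1 \<and> u ! (n - 1) = a2}"

definition suffix_subnetwork :: "nat \<Rightarrow> nat \<Rightarrow> nat \<Rightarrow> nat list set" where
  "suffix_subnetwork n a1 a2 =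
     {u \<in> pverts (bubble_sort_network n). u ! (n - 2) = a1 \<and> u ! (n - 1) = a2}"

definition prefix_subnetworks :: "nat \<Rightarrow> nat list set set" where
  "prefix_subnetworks n =
     {prefix_subnetwork n a1 a2 | a1 a2. a1 \<in> {1..n} \<and> a2 \<in> {1..n} \<and> a1 \<noteq> a2}"

definition middle_subnetworks :: "nat \<Rightarrow> nat list set set" where
  "middle_subnetworks n =
     {middle_subnetwork n a1 a2 | a1 a2. a1 \<in> {1..n} \<and> a2 \<in> {1..n} \<and> a1 \<noteq> a2}"

definition suffix_subnetworks :: "nat \<Rightarrow> nat list set set" where
  "suffix_subnetworks n =
     {suffix_subnetwork n a1 a2 | a1 a2. a1 \<in> {1..n} \<and> a2 \<in> {1..n} \<and> a1 \<noteq> a2}"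

text \<open>
  An outcome \<open>\<omega>\<close> of the random node fault model assigns \<open>True\<close> to the fault-free nodes;
  \<open>False\<close> is only the dummy value of \<open>\<omega>\<close> outside the vertex set.
\<close>

definition node_fault_model :: "nat \<Rightarrow> real \<Rightarrow> (nat list \<Rightarrow> bool) pmf" where
  "node_fault_model n p =
     Pi_pmf (pverts (bubble_sort_network n)) False (\<lambda>_. bernoulli_pmf p)"

definition fault_free :: "(nat list \<Rightarrow> bool) \<Rightarrow> nat list set \<Rightarrow> bool" where
  "fault_free \<omega> H \<longleftrightarrow> (\<forall>u\<in>H. \<omega> u)"

text \<open>
  For \<open>n \<ge> 4\<close> the three forms are pairwise disjoint and distinct pairs of symbols give distinct
  vertex sets, so identifying a subnetwork with its vertex set loses no information
  (for \<open>n = 3\<close> the forms would overlap).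
\<close>

definition subnetwork_quadruples :: "nat \<Rightarrow> nat \<Rightarrow> nat \<Rightarrow> nat \<Rightarrow> nat list set set set" where
  "subnetwork_quadruples n i j k =
     {S. S \<subseteq> prefix_subnetworks n \<union> middle_subnetworks n \<union> suffix_subnetworks n \<and> card S = 4 \<and>
         card (S \<inter> prefix_subnetworks n) = i \<and>
         card (S \<inter> middle_subnetworks n) = j \<and>
         card (S \<inter> suffix_subnetworks n) = k}"

text \<open>
  A sum over quadruples of the probabilities of their being fault-free,
  not the probability that some quadruple is fault-free.
\<close>

definition fault_free_quadruples_prob ::
    "nat \<Rightarrow> real \<Rightarrow> nat \<Rightarrow> nat \<Rightarrow> nat \<Rightarrow> real" where
  "fault_free_quadruples_prob n p i j k =
     (\<Sum>S\<in>subnetwork_quadruples n i j k.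
        measure_pmf.prob (node_fault_model n p) {\<omega>. \<forall>H\<in>S. fault_free \<omega> H})"

end

theory Submission
  imports Defs
begin

text \<open>
  Distinct suffix subnetworks are disjoint, and a prefix subnetwork $a_1a_2X^{n-2}$ meets a suffix
  subnetwork $X^{n-2}b_1b_2$ in $(n-4)!$ vertices if the four symbols are distinct and in none
  otherwise. So the union of one prefix and three suffix subnetworks has $4(n-2)! - m(n-4)!$
  vertices, where $m$ is the number of suffixes whose symbols avoid $a_1, a_2$. There are
  $D = (n-2)(n-3)$ such suffix subnetworks and $N = 4n-6$ others, hence the coefficient of the
  corresponding power of $p$ is $n(n-1)\binom{D}{m}\binom{N}{3-m}$.
\<close>

section \<open>Permutations with prescribed entries, and sums over subsets\<close>

text \<open>Induction on the number of free positions: pinning one more position \<open>j\<close>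
  partitions the permutations by their entry there. That entry ranges over the symbols of
  \<open>A\<close> outside the image of \<open>I\<close>, and each class is counted by the induction
  hypothesis.\<close>

lemma card_permutations_of_set_fixing:
  assumes "finite A" and "I \<subseteq> {..<card A}" and "inj_on f I" and "f ` I \<subseteq> A"
  shows "card {u \<in> permutations_of_set A. \<forall>i\<in>I. u ! i = f i} = fact (card A - card I)"
  using assms(2-4)
proof (induction "card A - card I" arbitrary: I f)
  case 0
  have "finite I" using 0(2) finite_subset by blast
  moreover have "card I \<le> card A" using card_mono[OF _ 0(2)] by simp
  ultimately have I: "I = {..<card A}" using 0(1,2) by (intro card_subset_eq) auto
  \<comment> \<open>Every position is pinned, so \<open>f\<close> spells out the only candidate; by
    injectivity its image is all of \<open>A\<close>, which makes the candidate a
    permutation.\<close>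
  define xs where "xs = map f [0..<card A]"
  have "f ` I = A"
    using 0(3,4) assms(1) I by (intro card_subset_eq) (auto simp: card_image)
  hence "xs \<in> permutations_of_set A"
    using 0(3) I by (auto simp: permutations_of_set_def xs_def distinct_map atLeast0LessThan)
  moreover have "u = xs" if "u \<in> permutations_of_set A" "\<forall>i\<in>I. u ! i = f i" for u
    using that I length_finite_permutations_of_set[of u A]
    by (auto intro!: nth_equalityI simp: xs_def)
  moreover have "\<forall>i\<in>I. xs ! i = f i" using I by (simp add: xs_def)
  ultimately have "{u \<in> permutations_of_set A. \<forall>i\<in>I. u ! i = f i} = {xs}" by blast
  thus ?case using 0(1) by simp
next
  case (Suc k)
  have finI: "finite I" using Suc(3) finite_subset by blast
  have "I \<noteq> {..<card A}" using Suc(2) by auto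
  then obtain j where j: "j < card A" "j \<notin> I" using Suc(3) by blast
  \<comment> \<open>\<open>F v\<close> is the class of permutations with the entry \<open>v\<close>
    at the new position \<open>j\<close>.\<close>
  define F where
    "F v = {u \<in> permutations_of_set A. \<forall>i\<in>insert j I. u ! i = (f(j := v)) i}" for v
  have step: "{u \<in> permutations_of_set A. \<forall>i\<in>I. u ! i = f i} = (\<Union>v\<in>A - f ` I. F v)"
  proof (intro equalityI subsetI)
    fix u assume u: "u \<in> {u \<in> permutations_of_set A. \<forall>i\<in>I. u ! i = f i}"
    have l: "length u = card A" "set u = A" "distinct u"
      using u by (auto simp: permutations_of_set_def distinct_card)
    have "u ! j \<notin> f ` I"
    proof
      assume "u ! j \<in> f ` I"
      then obtain i where "i \<in> I" "u ! j = u ! i" using u by auto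
      thus False using l j Suc(3) nth_eq_iff_index_eq[of u j i] by auto
    qed
    moreover have "u \<in> F (u ! j)" using u j by (auto simp: F_def)
    moreover have "u ! j \<in> A" using l j nth_mem by metis
    ultimately show "u \<in> (\<Union>v\<in>A - f ` I. F v)" by blast
  next
    fix u assume "u \<in> (\<Union>v\<in>A - f ` I. F v)"
    then obtain v where "u \<in> F v" by blast
    moreover have "(f(j := v)) i = f i" if "i \<in> I" for i using that j by auto
    ultimately show "u \<in> {u \<in> permutations_of_set A. \<forall>i\<in>I. u ! i = f i}"
      unfolding F_def by fastforce
  qed
  have "card (F v) = fact k" if "v \<in> A - f ` I" for v
  proof -
    have k: "k = card A - card (insert j I)" using Suc(2) finI j by simp
    have "insert j I \<subseteq> {..<card A}" using Suc(3) j by auto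
    moreover have "inj_on (f(j := v)) (insert j I)"
      using Suc(4) that j by (auto simp: inj_on_def)
    moreover have "(f(j := v)) ` insert j I \<subseteq> A" using Suc(5) that by auto
    ultimately have "card (F v) = fact (card A - card (insert j I))"
      unfolding F_def by (rule Suc(1)[OF k])
    thus ?thesis using k by simp
  qed
  moreover have "card (\<Union>v\<in>A - f ` I. F v) = (\<Sum>v\<in>A - f ` I. card (F v))"
    using assms(1) by (intro card_UN_disjoint) (auto simp: F_def)
  moreover have "card (A - f ` I) = Suc k"
    using Suc finI by (simp add: card_Diff_subset card_image)
  ultimately have "card (\<Union>v\<in>A - f ` I. F v) = Suc k * fact k" by simp
  thus ?case unfolding step Suc(2)[symmetric] by simp
qed

text \<open>The event is a rectangle in the product space, with the trivial factor
  \<open>UNIV\<close> at the coordinates of \<open>V\<close> outside \<open>U\<close>. By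
  independence only the coordinates in \<open>U\<close> contribute, a factor \<open>p\<close>
  each.\<close>

lemma prob_Pi_pmf_bernoulli_all:
  assumes "finite V" and "U \<subseteq> V" and "0 \<le> p" and "p \<le> 1"
  shows "measure_pmf.prob (Pi_pmf V d (\<lambda>_. bernoulli_pmf p)) {\<omega>. \<forall>u\<in>U. \<omega> u} = p ^ card U"
proof -
  have "{\<omega>. \<forall>u\<in>U. \<omega> u} = Pi V (\<lambda>u. if u \<in> U then {True} else UNIV)"
    using assms(2) by (fastforce simp: Pi_iff)
  hence "measure_pmf.prob (Pi_pmf V d (\<lambda>_. bernoulli_pmf p)) {\<omega>. \<forall>u\<in>U. \<omega> u}
      = (\<Prod>u\<in>V. measure_pmf.prob (bernoulli_pmf p) (if u \<in> U then {True} else UNIV))"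
    using assms(1) by (simp add: measure_Pi_pmf_Pi)
  also have "\<dots> = (\<Prod>u\<in>V. if u \<in> U then p else 1)"
    using assms(3,4) by (intro prod.cong) (auto simp: measure_pmf_single)
  also have "\<dots> = p ^ card U"
    using assms(1,2) by (simp add: prod.If_cases Int_absorb1)
  finally show ?thesis .
qed

text \<open>By disjointness, \<open>S\<close> amounts to independent choices of
  \<open>S \<inter> A\<close> and \<open>S \<inter> B\<close>. This serves twice: to separate the
  prefix member of a quadruple from its suffix members, and to split a set of suffix subnetworks
  into those that meet the prefix one and the rest.\<close>

lemma sum_subsets_Un:
  assumes "finite A" and "finite B" and "A \<inter> B = {}"
  shows "(\<Sum>S | S \<subseteq> A \<union> B \<and> card (S \<inter> A) = i \<and> card (S \<inter> B) = j. g S)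
    = (\<Sum>K | K \<subseteq> A \<and> card K = i. \<Sum>L | L \<subseteq> B \<and> card L = j. g (K \<union> L))"
proof -
  have "(\<Sum>K | K \<subseteq> A \<and> card K = i. \<Sum>L | L \<subseteq> B \<and> card L = j. g (K \<union> L))
    = (\<Sum>(K, L)\<in>{K. K \<subseteq> A \<and> card K = i} \<times> {L. L \<subseteq> B \<and> card L = j}. g (K \<union> L))"
    using assms by (intro sum.cartesian_product)
  also have "\<dots> = (\<Sum>S | S \<subseteq> A \<union> B \<and> card (S \<inter> A) = i \<and> card (S \<inter> B) = j. g S)"
  proof (rule sum.reindex_bij_witness[of _ "\<lambda>S. (S \<inter> A, S \<inter> B)" "\<lambda>(K, L). K \<union> L"], goal_cases)
    case (1 x) thus ?case using assms(3) by auto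
  next
    case (2 x)
    then obtain K L where x: "x = (K, L)" "K \<subseteq> A" "card K = i" "L \<subseteq> B" "card L = j" by auto
    hence "(K \<union> L) \<inter> A = K" "(K \<union> L) \<inter> B = L" using assms(3) by auto
    thus ?case using x by auto
  next
    case (3 S) thus ?case by auto
  next
    case (4 S) thus ?case by auto
  next
    case (5 x) thus ?case by auto
  qed
  finally show ?thesis by simp
qed

text \<open>A weighted Vandermonde identity: group the sets \<open>L\<close> by
  \<open>m = card (L \<inter> A)\<close>, then choose \<open>m\<close> elements inside
  \<open>A\<close> and \<open>k - m\<close> outside.\<close>

lemma sum_subsets_by_card_Int:
  fixes g :: "nat \<Rightarrow> 'a :: comm_semiring_1"
  assumes "finite B" and "A \<subseteq> B"
  shows "(\<Sum>L | L \<subseteq> B \<and> card L = k. g (card (L \<inter> A)))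
    = (\<Sum>m\<le>k. of_nat ((card A choose m) * (card (B - A) choose (k - m))) * g m)"
proof -
  have finA: "finite A" using assms finite_subset by blast
  \<comment> \<open>This yields both the bound \<open>card (L \<inter> A) \<le> k\<close> that
    \<open>sum.group\<close> requires and the size \<open>k - m\<close> of the remaining
    part.\<close>
  have split: "card L = card (L \<inter> A) + card (L \<inter> (B - A))" if "L \<subseteq> B" for L
  proof -
    have "finite L" using that assms(1) finite_subset by blast
    moreover have "L \<inter> (B - A) = L - A" using that by blast
    ultimately show ?thesis using card_Int_Diff[of L A] by simp
  qed
  have "(\<Sum>L | L \<subseteq> B \<and> card L = k. g (card (L \<inter> A)))
    = (\<Sum>m\<le>k. \<Sum>L | L \<in> {L. L \<subseteq> B \<and> card L = k} \<and> card (L \<inter> A) = m. g (card (L \<inter> A)))"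
    using assms(1) split by (intro sum.group[symmetric]) auto
  also have "\<dots> = (\<Sum>m\<le>k. of_nat ((card A choose m) * (card (B - A) choose (k - m))) * g m)"
  proof (rule sum.cong[OF refl])
    fix m assume m: "m \<in> {..k}"
    have eq: "{L. L \<in> {L. L \<subseteq> B \<and> card L = k} \<and> card (L \<inter> A) = m}
      = {L. L \<subseteq> A \<union> (B - A) \<and> card (L \<inter> A) = m \<and> card (L \<inter> (B - A)) = k - m}" (is "?X = ?Y")
    proof (rule Collect_cong)
      fix L
      show "(L \<in> {L. L \<subseteq> B \<and> card L = k} \<and> card (L \<inter> A) = m)
        = (L \<subseteq> A \<union> (B - A) \<and> card (L \<inter> A) = m \<and> card (L \<inter> (B - A)) = k - m)"
        using split[of L] m assms(2) by (auto simp: Un_absorb1)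
    qed
    have "(\<Sum>L\<in>?X. g (card (L \<inter> A))) = (\<Sum>L\<in>?Y. g m)"
      by (intro sum.cong eq) auto
    also have "\<dots> = (\<Sum>K | K \<subseteq> A \<and> card K = m. \<Sum>L | L \<subseteq> B - A \<and> card L = k - m. g m)"
      using finA assms(1) by (intro sum_subsets_Un) auto
    also have "\<dots> = of_nat ((card A choose m) * (card (B - A) choose (k - m))) * g m"
      using finA assms(1) by (simp add: n_subsets mult.assoc)
    finally show "(\<Sum>L\<in>?X. g (card (L \<inter> A)))
      = of_nat ((card A choose m) * (card (B - A) choose (k - m))) * g m" .
  qed
  finally show ?thesis .
qed

lemma card_permutations_of_set_fixing_list:
  assumes "finite A" and "distinct js" and "set js \<subseteq> {..<card A}"
    and "distinct vs" and "set vs \<subseteq> A" and "length js = k" and "length vs = k"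
  shows "card {u \<in> permutations_of_set A. map ((!) u) js = vs} = fact (card A - k)"
proof -
  \<comment> \<open>Lookup in the association list; distinctness of \<open>js\<close> ensures that
    each position finds its own value.\<close>
  define f where "f = (\<lambda>i. the (map_of (zip js vs) i))"
  have f: "map f js = vs"
    using assms(2,6,7) by (intro nth_equalityI) (auto simp: f_def map_of_zip_nth)
  hence "inj_on f (set js)" "f ` set js \<subseteq> A"
    using assms(4,5) by (auto simp: distinct_map)
  moreover have "map ((!) u) js = vs \<longleftrightarrow> (\<forall>i\<in>set js. u ! i = f i)" for u
    unfolding f[symmetric] by simp
  ultimately show ?thesis
    using card_permutations_of_set_fixing[OF assms(1,3)] assms(2,6) by (simp add: distinct_card)
qed

section \<open>Distinctness, sizes and intersections of subnetworks\<close>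

lemma pverts_bubble_sort_network [simp]:
  "pverts (bubble_sort_network n) = permutations_of_set {1..n}"
  by (simp add: bubble_sort_network_def)

lemma nth_eq_iff_permutations_of_set:
  assumes "u \<in> permutations_of_set {1..n}" and "i < n" and "j < n"
  shows "u ! i = u ! j \<longleftrightarrow> i = j"
  using assms length_finite_permutations_of_set[OF assms(1)]
  by (auto simp: permutations_of_set_def nth_eq_iff_index_eq)

text \<open>Since \<open>n \<ge> 4\<close>, some symbol lies outside \<open>{a, b, c}\<close> and
  can be placed at position \<open>k\<close>. The resulting permutation witnesses that subnetworks
  of different forms differ.\<close>

lemma exists_permutation_avoiding:
  assumes "n \<ge> 4" and "i < n" "j < n" "k < n" and "distinct [i, j, k]"
    and "a \<in> {1..n}" "b \<in> {1..n}" and "a \<noteq> b"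
  obtains u where "u \<in> permutations_of_set {1..n}" "u ! i = a" "u ! j = b" "u ! k \<noteq> c"
proof -
  have "card {a, b, c} \<le> 3" by (simp add: card_insert_if)
  hence "\<not> {1..n} \<subseteq> {a, b, c}"
    using assms(1) card_mono[of "{a, b, c}" "{1..n}"] by auto
  then obtain e where e: "e \<in> {1..n}" "e \<notin> {a, b, c}" by blast
  \<comment> \<open>The cardinality is \<open>fact (n - 3)\<close>, which is never zero.\<close>
  have "card {u \<in> permutations_of_set {1..n}. map ((!) u) [i, j, k] = [a, b, e]} \<noteq> 0"
    using assms e by (subst card_permutations_of_set_fixing_list[where k = 3]) auto
  then obtain u where "u \<in> permutations_of_set {1..n}" "map ((!) u) [i, j, k] = [a, b, e]"
    by (metis (mono_tags, lifting) Collect_empty_eq card.empty)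
  thus ?thesis using e by (intro that[of u]) auto
qed

text \<open>Each comparison uses a position that the second form fixes and the first leaves free:
  the last one for prefix against middle or suffix, the first one for suffix against middle. The
  families are disjoint here; vertex sets of different forms may still intersect.\<close>

lemma subnetwork_forms_disjoint:
  assumes "n \<ge> 4"
  shows "prefix_subnetworks n \<inter> middle_subnetworks n = {}"
    and "suffix_subnetworks n \<inter> middle_subnetworks n = {}"
    and "prefix_subnetworks n \<inter> suffix_subnetworks n = {}"
proof -
  have pos: "0 < n" "1 < n" "n - 1 < n" "n - 2 < n" "distinct [0, 1, n - 1]"
    "distinct [n - 2, n - 1, 0]"
    using assms by auto
  have "prefix_subnetwork n a b \<noteq> middle_subnetwork n c d"
    "prefix_subnetwork n a b \<noteq> suffix_subnetwork n c d"
    if ab: "a \<in> {1..n}" "b \<in> {1..n}" "a \<noteq> b" for a b c d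
  proof -
    obtain u where "u \<in> permutations_of_set {1..n}" "u ! 0 = a" "u ! 1 = b" "u ! (n - 1) \<noteq> d"
      using exists_permutation_avoiding[OF assms pos(1,2,3,5) ab] by blast
    hence "u \<in> prefix_subnetwork n a b" "u \<notin> middle_subnetwork n c d"
      "u \<notin> suffix_subnetwork n c d"
      by (auto simp: prefix_subnetwork_def middle_subnetwork_def suffix_subnetwork_def)
    thus "prefix_subnetwork n a b \<noteq> middle_subnetwork n c d"
      "prefix_subnetwork n a b \<noteq> suffix_subnetwork n c d" by auto
  qed
  moreover have "suffix_subnetwork n a b \<noteq> middle_subnetwork n c d"
    if ab: "a \<in> {1..n}" "b \<in> {1..n}" "a \<noteq> b" for a b c d
  proof -
    obtain u where "u \<in> permutations_of_set {1..n}" "u ! (n - 2) = a" "u ! (n - 1) = b" "u ! 0 \<noteq> c"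
      using exists_permutation_avoiding[OF assms pos(4,3,1,6) ab] by blast
    hence "u \<in> suffix_subnetwork n a b" "u \<notin> middle_subnetwork n c d"
      by (auto simp: middle_subnetwork_def suffix_subnetwork_def)
    thus ?thesis by auto
  qed
  ultimately show "prefix_subnetworks n \<inter> middle_subnetworks n = {}"
    and "suffix_subnetworks n \<inter> middle_subnetworks n = {}"
    and "prefix_subnetworks n \<inter> suffix_subnetworks n = {}"
    unfolding prefix_subnetworks_def middle_subnetworks_def suffix_subnetworks_def by blast+
qed

lemma card_subnetwork:
  assumes "n \<ge> 2" and "a \<in> {1..n}" and "b \<in> {1..n}" and "a \<noteq> b"
  shows "card (prefix_subnetwork n a b) = fact (n - 2)"
    and "card (suffix_subnetwork n a b) = fact (n - 2)"
proof -
  have "card {u \<in> permutations_of_set {1..n}. map ((!) u) [i, j] = [a, b]} = fact (n - 2)"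
    if "i < n" "j < n" "i \<noteq> j" for i j
    using assms that by (subst card_permutations_of_set_fixing_list[where k = 2]) auto
  from this[of 0 1] this[of "n - 2" "n - 1"]
  show "card (prefix_subnetwork n a b) = fact (n - 2)"
    and "card (suffix_subnetwork n a b) = fact (n - 2)"
    using assms(1) by (simp_all add: prefix_subnetwork_def suffix_subnetwork_def)
qed

text \<open>For \<open>n \<ge> 4\<close> the positions \<open>0\<close>, \<open>1\<close>,
  \<open>n - 2\<close>, \<open>n - 1\<close> are distinct. A common vertex therefore has four pinned
  entries, and a symbol shared by the two pairs would have to occur in it twice.\<close>

lemma card_prefix_Int_suffix:
  assumes "n \<ge> 4" and "a \<in> {1..n}" "b \<in> {1..n}" "a \<noteq> b"
    and "c \<in> {1..n}" "d \<in> {1..n}" "c \<noteq> d"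
  shows "card (prefix_subnetwork n a b \<inter> suffix_subnetwork n c d)
    = (if {a, b} \<inter> {c, d} = {} then fact (n - 4) else 0)"
proof (cases "{a, b} \<inter> {c, d} = {}")
  case True
  have "prefix_subnetwork n a b \<inter> suffix_subnetwork n c d
    = {u \<in> permutations_of_set {1..n}. map ((!) u) [0, 1, n - 2, n - 1] = [a, b, c, d]}"
    by (auto simp: prefix_subnetwork_def suffix_subnetwork_def)
  also have "card \<dots> = fact (n - 4)"
    using assms True
    by (subst card_permutations_of_set_fixing_list[where k = 4]) auto
  finally show ?thesis using True by simp
next
  case False
  have "{a, b} \<inter> {c, d} = {}"
    if "u \<in> prefix_subnetwork n a b" and "u \<in> suffix_subnetwork n c d" for u
  proof -
    have u: "u \<in> permutations_of_set {1..n}"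
      and abcd: "a = u ! 0" "b = u ! 1" "c = u ! (n - 2)" "d = u ! (n - 1)"
      using that by (auto simp: prefix_subnetwork_def suffix_subnetwork_def)
    show ?thesis
      unfolding abcd using nth_eq_iff_permutations_of_set[OF u] assms(1) by simp
  qed
  with False have "prefix_subnetwork n a b \<inter> suffix_subnetwork n c d = {}" by blast
  thus ?thesis using False by simp
qed

section \<open>Indexing subnetworks by pairs of symbols\<close>

text \<open>The \<open>SIGMA\<close> form makes finiteness and cardinality immediate. Over
  \<open>{1..n}\<close> it indexes all subnetworks of one form, over \<open>{1..n} - {a, b}\<close>
  the suffix subnetworks avoiding the symbols of a given prefix.\<close>

definition off_diagonal :: "'a set \<Rightarrow> ('a \<times> 'a) set" where
  "off_diagonal A = (SIGMA a:A. A - {a})"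

lemma finite_off_diagonal [simp]: "finite A \<Longrightarrow> finite (off_diagonal A)"
  by (simp add: off_diagonal_def)

lemma card_off_diagonal: "finite A \<Longrightarrow> card (off_diagonal A) = card A * (card A - 1)"
  by (simp add: off_diagonal_def)

lemma prefix_subnetworks_eq_image:
  "prefix_subnetworks n = case_prod (prefix_subnetwork n) ` off_diagonal {1..n}"
  unfolding prefix_subnetworks_def off_diagonal_def by force

lemma suffix_subnetworks_eq_image:
  "suffix_subnetworks n = case_prod (suffix_subnetwork n) ` off_diagonal {1..n}"
  unfolding suffix_subnetworks_def off_diagonal_def by force

text \<open>Any vertex of a subnetwork shows both symbols at the fixed positions, and a vertex
  exists because the cardinality is a factorial. Hence the vertex set determines the pair.\<close>

lemma inj_on_subnetwork:
  assumes "n \<ge> 2"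
  shows "inj_on (case_prod (prefix_subnetwork n)) (off_diagonal {1..n})"
    and "inj_on (case_prod (suffix_subnetwork n)) (off_diagonal {1..n})"
proof -
  have ne: "prefix_subnetwork n a b \<noteq> {}" "suffix_subnetwork n a b \<noteq> {}"
    if "(a, b) \<in> off_diagonal {1..n}" for a b
    using card_subnetwork[of n a b] assms that by (force simp: off_diagonal_def)+
  show "inj_on (case_prod (prefix_subnetwork n)) (off_diagonal {1..n})"
    using ne(1) by (intro inj_onI) (force simp: prefix_subnetwork_def)
  show "inj_on (case_prod (suffix_subnetwork n)) (off_diagonal {1..n})"
    using ne(2) by (intro inj_onI) (force simp: suffix_subnetwork_def)
qed

section \<open>Size of a union of one prefix and several suffix subnetworks\<close>

text \<open>\<open>E\<close> collects the suffix subnetworks that meet the prefix one. The members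
  of \<open>L\<close> are pairwise disjoint, so inclusion-exclusion has to correct only for their
  overlaps with the prefix subnetwork.\<close>

lemma card_Union_prefix_suffixes:
  assumes "n \<ge> 4" and "(a, b) \<in> off_diagonal {1..n}" and "L \<subseteq> suffix_subnetworks n"
  defines "E \<equiv> case_prod (suffix_subnetwork n) ` off_diagonal ({1..n} - {a, b})"
  shows "card (\<Union> (insert (prefix_subnetwork n a b) L))
    = (card L + 1) * fact (n - 2) - card (L \<inter> E) * fact (n - 4)"
proof -
  let ?H = "prefix_subnetwork n a b"
  have ab: "a \<in> {1..n}" "b \<in> {1..n}" "a \<noteq> b" using assms(2) by (auto simp: off_diagonal_def)
  have finL: "finite L"
    using assms(3) by (rule finite_subset) (simp add: suffix_subnetworks_eq_image)
  have L: "\<exists>c d. x = suffix_subnetwork n c d \<and> c \<in> {1..n} \<and> d \<in> {1..n} \<and> c \<noteq> d" if "x \<in> L" for x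
    using that assms(3) by (auto simp: suffix_subnetworks_def)
  have fin: "finite (suffix_subnetwork n c d)" "finite (prefix_subnetwork n c d)" for c d
    by (auto simp: suffix_subnetwork_def prefix_subnetwork_def)
  have finx: "finite x" if "x \<in> L" for x using L[OF that] fin by auto
  \<comment> \<open>A common vertex would show the same last two symbols for both, making them
    equal.\<close>
  have disj: "x \<inter> y = {}" if "x \<in> L" "y \<in> L" "x \<noteq> y" for x y
    using L[OF that(1)] L[OF that(2)] that(3) by (auto simp: suffix_subnetwork_def)
  have cardx: "card x = fact (n - 2)" if "x \<in> L" for x
    using L[OF that] card_subnetwork(2) assms(1) by auto
  have inter: "card (?H \<inter> x) = (if x \<in> E then fact (n - 4) else 0)" if x: "x \<in> L" for x
  proof -
    obtain c d where cd: "x = suffix_subnetwork n c d" "c \<in> {1..n}" "d \<in> {1..n}" "c \<noteq> d"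
      using L[OF x] by blast
    have Q: "(c, d) \<in> off_diagonal {1..n}" using cd by (simp add: off_diagonal_def)
    \<comment> \<open>Injectivity of the indexing lets membership of the vertex set \<open>x\<close>
      in the image \<open>E\<close> be read off the pair \<open>(c, d)\<close>.\<close>
    have "off_diagonal ({1..n} - {a, b}) \<subseteq> off_diagonal {1..n}"
      by (auto simp: off_diagonal_def)
    from inj_on_image_mem_iff[OF inj_on_subnetwork(2) Q this]
    have "x \<in> E \<longleftrightarrow> (c, d) \<in> off_diagonal ({1..n} - {a, b})"
      unfolding E_def cd(1) using assms(1) by simp
    also have "\<dots> \<longleftrightarrow> {a, b} \<inter> {c, d} = {}" using cd by (auto simp: off_diagonal_def)
    finally show ?thesis
      unfolding cd(1) using card_prefix_Int_suffix[OF assms(1) ab cd(2-4)] by simp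
  qed
  have "card (\<Union> L) = (\<Sum>x\<in>L. card x)"
    using disj finx by (intro card_Union_disjoint) (auto simp: pairwise_def disjnt_def)
  hence 1: "card (\<Union> L) = card L * fact (n - 2)" using cardx by simp
  have "?H \<inter> \<Union> L = (\<Union>x\<in>L. ?H \<inter> x)" by blast
  also have "card \<dots> = (\<Sum>x\<in>L. card (?H \<inter> x))"
    using disj finL fin by (intro card_UN_disjoint) auto
  also have "\<dots> = (\<Sum>x\<in>L. if x \<in> E then fact (n - 4) else 0)"
    using inter by (rule sum.cong[OF refl])
  also have "\<dots> = card (L \<inter> E) * fact (n - 4)"
    using finL by (simp add: sum.If_cases)
  finally have 2: "card (?H \<inter> \<Union> L) = card (L \<inter> E) * fact (n - 4)" .
  have "finite (\<Union> L)" using finL finx by blast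
  \<comment> \<open>\<open>card_Un_Int\<close> is an additive identity, so the natural-number
    subtraction in the claim is exact.\<close>
  from card_Un_Int[OF fin(2) this, of a b] 1 2 show ?thesis
    using card_subnetwork(1)[of n a b] assms(1) ab by simp
qed

section \<open>Reduction of the quadruple sum to binomial coefficients\<close>

text \<open>Brings the index set into the shape that \<open>sum_subsets_Un\<close> handles.\<close>

lemma subnetwork_quadruples_no_middle:
  assumes "n \<ge> 4" and "i + k = 4"
  shows "subnetwork_quadruples n i 0 k =
    {S. S \<subseteq> prefix_subnetworks n \<union> suffix_subnetworks n \<and>
        card (S \<inter> prefix_subnetworks n) = i \<and> card (S \<inter> suffix_subnetworks n) = k}"
    (is "_ = ?R")
proof (intro equalityI subsetI)
  fix S assume S: "S \<in> subnetwork_quadruples n i 0 k"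
  \<comment> \<open>Finiteness, from \<open>card S = 4\<close>, is needed to conclude from
    cardinality zero that \<open>S\<close> has no middle member.\<close>
  hence "finite S" by (auto simp: subnetwork_quadruples_def intro: card_ge_0_finite)
  thus "S \<in> ?R" using S by (auto simp: subnetwork_quadruples_def)
next
  fix S assume S: "S \<in> ?R"
  let ?P = "prefix_subnetworks n" and ?T = "suffix_subnetworks n"
  have "finite S"
    using S finite_subset[of S "?P \<union> ?T"]
    by (auto simp: prefix_subnetworks_eq_image suffix_subnetworks_eq_image)
  moreover have "S - ?P = S \<inter> ?T" using S subnetwork_forms_disjoint[OF assms(1)] by blast
  ultimately have "card S = 4" using card_Int_Diff[of S ?P] S assms(2) by simp
  moreover have "S \<inter> middle_subnetworks n = {}"
    using S subnetwork_forms_disjoint[OF assms(1)] by blast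
  ultimately show "S \<in> subnetwork_quadruples n i 0 k"
    using S by (auto simp: subnetwork_quadruples_def)
qed

lemma prob_fault_free_subnetworks:
  assumes "\<Union> S \<subseteq> permutations_of_set {1..n}" and "0 \<le> p" and "p \<le> 1"
  shows "measure_pmf.prob (node_fault_model n p) {\<omega>. \<forall>H\<in>S. fault_free \<omega> H} = p ^ card (\<Union> S)"
proof -
  have "{\<omega>. \<forall>H\<in>S. fault_free \<omega> H} = {\<omega>. \<forall>u\<in>\<Union> S. \<omega> u}"
    by (auto simp: fault_free_def)
  thus ?thesis
    using prob_Pi_pmf_bernoulli_all[OF _ assms] by (simp add: node_fault_model_def)
qed

text \<open>For each prefix subnetwork, exactly \<open>D\<close> of the \<open>n * (n - 1)\<close>
  suffix subnetworks meet it, and the exponent depends only on how many of these are among the three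
  chosen.\<close>

lemma fault_free_quadruples_prob_1_0_3:
  assumes "n \<ge> 4" and "0 \<le> p" and "p \<le> 1"
  defines "D \<equiv> (n - 2) * (n - 3)"
  shows "fault_free_quadruples_prob n p 1 0 3 =
    (\<Sum>m\<le>3. real (n * (n - 1) * ((D choose m) * (n * (n - 1) - D choose (3 - m))))
       * p ^ (4 * fact (n - 2) - m * fact (n - 4)))"
proof -
  let ?P = "prefix_subnetworks n" and ?T = "suffix_subnetworks n"
  let ?Q = "off_diagonal {1..n}"
  have finP: "finite ?P" and finT: "finite ?T"
    by (simp_all add: prefix_subnetworks_eq_image suffix_subnetworks_eq_image)
  have cardT: "card ?T = n * (n - 1)"
    using inj_on_subnetwork(2)[of n] assms(1)
    by (simp add: suffix_subnetworks_eq_image card_image card_off_diagonal)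
  \<comment> \<open>For a fixed prefix subnetwork, \<open>c m\<close> counts the triples of suffix
    subnetworks with \<open>m\<close> members meeting it, and \<open>w m\<close> is the probability
    that such a quadruple is fault-free.\<close>
  define w where "w m = p ^ (4 * fact (n - 2) - m * fact (n - 4))" for m :: nat
  define c where "c m = (D choose m) * (n * (n - 1) - D choose (3 - m))" for m
  have inner: "(\<Sum>L | L \<subseteq> ?T \<and> card L = 3. p ^ card (\<Union> (insert (prefix_subnetwork n a b) L)))
    = (\<Sum>m\<le>3. real (c m) * w m)" if ab: "(a, b) \<in> ?Q" for a b
  proof -
    define E where "E = case_prod (suffix_subnetwork n) ` off_diagonal ({1..n} - {a, b})"
    have sub: "off_diagonal ({1..n} - {a, b}) \<subseteq> ?Q" by (auto simp: off_diagonal_def)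
    have ET: "E \<subseteq> ?T" unfolding E_def suffix_subnetworks_eq_image using sub by blast
    have "card E = card (off_diagonal ({1..n} - {a, b}))"
      unfolding E_def using inj_on_subset[OF inj_on_subnetwork(2) sub] assms(1)
      by (intro card_image) simp
    moreover have "card ({1..n} - {a, b}) = n - 2"
      using ab by (subst card_Diff_subset) (auto simp: off_diagonal_def numeral_2_eq_2)
    hence "card (off_diagonal ({1..n} - {a, b})) = D"
      by (simp add: card_off_diagonal D_def)
    ultimately have cardE: "card E = D" by simp
    have "(\<Sum>L | L \<subseteq> ?T \<and> card L = 3. p ^ card (\<Union> (insert (prefix_subnetwork n a b) L)))
      = (\<Sum>L | L \<subseteq> ?T \<and> card L = 3. w (card (L \<inter> E)))"
      using card_Union_prefix_suffixes[OF assms(1) ab]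
      by (intro sum.cong) (auto simp: w_def E_def)
    also have "\<dots> = (\<Sum>m\<le>3. real (c m) * w m)"
      using sum_subsets_by_card_Int[OF finT ET] cardE cardT finite_subset[OF ET finT] ET
      by (simp add: card_Diff_subset c_def)
    finally show ?thesis .
  qed
  have PT: "\<Union> S \<subseteq> permutations_of_set {1..n}" if "S \<subseteq> ?P \<union> ?T" for S
    using that by (force simp: prefix_subnetworks_def suffix_subnetworks_def
        prefix_subnetwork_def suffix_subnetwork_def)
  have "fault_free_quadruples_prob n p 1 0 3
    = (\<Sum>S | S \<subseteq> ?P \<union> ?T \<and> card (S \<inter> ?P) = 1 \<and> card (S \<inter> ?T) = 3. p ^ card (\<Union> S))"
    unfolding fault_free_quadruples_prob_def
    using subnetwork_quadruples_no_middle[OF assms(1), of 1 3]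
      prob_fault_free_subnetworks[OF PT assms(2,3)]
    by (intro sum.cong) auto
  also have "\<dots> = (\<Sum>K | K \<subseteq> ?P \<and> card K = 1. \<Sum>L | L \<subseteq> ?T \<and> card L = 3. p ^ card (\<Union> (K \<union> L)))"
    using finP finT subnetwork_forms_disjoint(3)[OF assms(1)] by (rule sum_subsets_Un)
  \<comment> \<open>The prefix part is a singleton, so the outer sum can be reindexed by pairs of
    symbols.\<close>
  also have "{K. K \<subseteq> ?P \<and> card K = 1} = (\<lambda>(a, b). {prefix_subnetwork n a b}) ` ?Q"
    by (auto simp: card_1_singleton_iff prefix_subnetworks_eq_image)
  also have "(\<Sum>K\<in>(\<lambda>(a, b). {prefix_subnetwork n a b}) ` ?Q.
      \<Sum>L | L \<subseteq> ?T \<and> card L = 3. p ^ card (\<Union> (K \<union> L)))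
    = (\<Sum>(a, b)\<in>?Q. \<Sum>L | L \<subseteq> ?T \<and> card L = 3.
        p ^ card (\<Union> (insert (prefix_subnetwork n a b) L)))"
  proof (subst sum.reindex)
    show "inj_on (\<lambda>(a, b). {prefix_subnetwork n a b}) ?Q"
      using inj_on_subnetwork(1)[of n] assms(1) by (auto simp: inj_on_def)
  qed (auto intro!: sum.cong)
  also have "\<dots> = (\<Sum>(a, b)\<in>?Q. \<Sum>m\<le>3. real (c m) * w m)"
    using inner by (intro sum.cong) auto
  \<comment> \<open>The summand is independent of \<open>(a, b)\<close>, so only the number of pairs
    enters.\<close>
  also have "\<dots> = real (n * (n - 1)) * (\<Sum>m\<le>3. real (c m) * w m)"
    by (simp add: card_off_diagonal case_prod_unfold)
  finally show ?thesis
    unfolding c_def w_def by (simp add: sum_distrib_left mult.assoc)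
qed

section \<open>Expansion of the coefficients into polynomials\<close>

text \<open>Passing to the reals keeps this valid for small \<open>k\<close> as well: both sides
  vanish for \<open>k < 2\<close>.\<close>

lemma of_nat_choose_2: "real (k choose 2) = real k * (real k - 1) / 2"
  by (simp add: binomial_gbinomial gbinomial_prod_rev numeral_2_eq_2)

lemma of_nat_choose_3: "real (k choose 3) = real k * (real k - 1) * (real k - 2) / 6"
  by (simp add: binomial_gbinomial gbinomial_prod_rev numeral_3_eq_3)

theorem theorem5:
  fixes n :: nat and p :: real
  assumes "n \<ge> 4" and "0 \<le> p" and "p \<le> 1"
  shows "fault_free_quadruples_prob n p 1 0 3 =
      4 / 3 * (8 * real n ^ 5 - 50 * real n ^ 4 + 115 * real n ^ 3 - 115 * real n ^ 2 + 42 * real n)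
        * p ^ (4 * fact (n - 2))
    + (8 * real n ^ 6 - 74 * real n ^ 5 + 265 * real n ^ 4 - 460 * real n ^ 3
         + 387 * real n ^ 2 - 126 * real n)
        * p ^ (4 * fact (n - 2) - fact (n - 4))
    + (2 * real n ^ 7 - 25 * real n ^ 6 + 125 * real n ^ 5 - 320 * real n ^ 4
         + 443 * real n ^ 3 - 315 * real n ^ 2 + 90 * real n)
        * p ^ (4 * fact (n - 2) - 2 * fact (n - 4))
    + 1 / 6 * (real n ^ 8 - 16 * real n ^ 7 + 105 * real n ^ 6 - 365 * real n ^ 5
         + 724 * real n ^ 4 - 819 * real n ^ 3 + 490 * real n ^ 2 - 120 * real n)
        * p ^ (4 * fact (n - 2) - 3 * fact (n - 4))"
proof -
  define x where "x = real n"
  define D where "D = (n - 2) * (n - 3)"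
  define N where "N = n * (n - 1) - D"
  define w where "w m = p ^ (4 * fact (n - 2) - m * fact (n - 4))" for m :: nat
  have n: "real (n * (n - 1)) = x * (x - 1)"
    using assms(1) by (simp add: x_def of_nat_diff)
  have D: "real D = (x - 2) * (x - 3)"
    using assms(1) by (simp add: D_def x_def of_nat_diff)
  \<comment> \<open>This bound lets the natural-number subtraction in \<open>N\<close> be carried
    over to the reals.\<close>
  have "D \<le> n * (n - 1)" unfolding D_def by (intro mult_le_mono) auto
  hence N: "real N = 4 * x - 6"
    using of_nat_diff[of D "n * (n - 1)", where 'a = real] unfolding n D N_def
    by (simp add: algebra_simps)
  \<comment> \<open>\<open>algebra\<close> takes too long on the degree-8 identity unless the product is split.\<close>
  have "x * (x - 1) * ((x - 2) * (x - 3)) = x ^ 4 - 6 * x ^ 3 + 11 * x ^ 2 - 6 * x"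
    by algebra
  moreover have "((x - 2) * (x - 3) - 1) * ((x - 2) * (x - 3) - 2)
    = x ^ 4 - 10 * x ^ 3 + 34 * x ^ 2 - 45 * x + 20"
    by algebra
  moreover have "(x ^ 4 - 6 * x ^ 3 + 11 * x ^ 2 - 6 * x)
      * (x ^ 4 - 10 * x ^ 3 + 34 * x ^ 2 - 45 * x + 20)
    = x ^ 8 - 16 * x ^ 7 + 105 * x ^ 6 - 365 * x ^ 5 + 724 * x ^ 4 - 819 * x ^ 3
        + 490 * x ^ 2 - 120 * x"
    by algebra
  ultimately have degree_8: "x * (x - 1) * ((x - 2) * (x - 3))
      * (((x - 2) * (x - 3) - 1) * ((x - 2) * (x - 3) - 2))
    = x ^ 8 - 16 * x ^ 7 + 105 * x ^ 6 - 365 * x ^ 5 + 724 * x ^ 4 - 819 * x ^ 3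
        + 490 * x ^ 2 - 120 * x"
    by (simp only:)
  \<comment> \<open>\<open>c0\<close> to \<open>c3\<close> expand
    \<open>n * (n - 1) * (D choose m) * (N choose (3 - m))\<close> for \<open>m\<close> from 0 to 3,
    with \<open>D = (x - 2) * (x - 3)\<close> and \<open>N = 4 * x - 6\<close> over the
    reals.\<close>
  have c0: "x * (x - 1) * ((4 * x - 6) * (4 * x - 7) * (4 * x - 8) / 6)
    = 4 / 3 * (8 * x ^ 5 - 50 * x ^ 4 + 115 * x ^ 3 - 115 * x ^ 2 + 42 * x)"
    by algebra
  have c1: "x * (x - 1) * ((x - 2) * (x - 3) * ((4 * x - 6) * (4 * x - 7) / 2))
    = 8 * x ^ 6 - 74 * x ^ 5 + 265 * x ^ 4 - 460 * x ^ 3 + 387 * x ^ 2 - 126 * x"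
    by algebra
  have c2: "x * (x - 1) * ((x - 2) * (x - 3) * ((x - 2) * (x - 3) - 1) / 2 * (4 * x - 6))
    = 2 * x ^ 7 - 25 * x ^ 6 + 125 * x ^ 5 - 320 * x ^ 4 + 443 * x ^ 3 - 315 * x ^ 2 + 90 * x"
    by algebra
  have c3: "x * (x - 1) *
      ((x - 2) * (x - 3) * ((x - 2) * (x - 3) - 1) * ((x - 2) * (x - 3) - 2) / 6)
    = 1 / 6 * (x ^ 8 - 16 * x ^ 7 + 105 * x ^ 6 - 365 * x ^ 5 + 724 * x ^ 4 - 819 * x ^ 3
        + 490 * x ^ 2 - 120 * x)"
    using degree_8 by (simp add: mult.assoc)
  \<comment> \<open>Listing the index set explicitly lets the simplifier unfold the sum into its
    four terms.\<close>
  have "fault_free_quadruples_prob n p 1 0 3 =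
    (\<Sum>m\<in>{0, 1, 2, 3}. real (n * (n - 1)) * (real (D choose m) *
       real (N choose (3 - m))) * w m)"
    unfolding fault_free_quadruples_prob_1_0_3[OF assms] D_def N_def w_def
    by (intro sum.cong) auto
  also have "\<dots> =
      x * (x - 1) * ((4 * x - 6) * (4 * x - 7) * (4 * x - 8) / 6) * w 0
    + x * (x - 1) * ((x - 2) * (x - 3) * ((4 * x - 6) * (4 * x - 7) / 2)) * w 1
    + x * (x - 1) * ((x - 2) * (x - 3) * ((x - 2) * (x - 3) - 1) / 2 * (4 * x - 6)) * w 2
    + x * (x - 1) * ((x - 2) * (x - 3) * ((x - 2) * (x - 3) - 1) * ((x - 2) * (x - 3) - 2) / 6) * w 3"
    unfolding n by (simp add: of_nat_choose_2 of_nat_choose_3 D N)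
  finally show ?thesis
    unfolding c0 c1 c2 c3 unfolding x_def w_def by (simp only: mult_0 mult_1 diff_zero)
qed

end
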